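(* Let $k \ge 2$ be an integer and let $S=(s_1,s_2,\ldots)$ be a packing sequence with $S \in \mathcal{S}(k)$, i.e. $2^{i-1} \le s_i < 2^i$ for all $i \le k-1$ and $s_k < 2^{k-1}$. Then for every path $P_n$ of order $n \ge 1$, $$\chi_S(P_n) = \min\{k, \lfloor \log_2(n) \rfloor + 1\}.$$ In particular, if $n \ge 2^{k-1}$, then $\chi_S(P_n) = k$.
   Context: A packing sequence is a non-decreasing infinite sequence $S=(s_1,s_2,\ldots)$ of positive integers. For a graph $G$, a map $\phi\colon V(G)\to\{1,\ldots,k\}$ is an $S$-packing $k$-coloring if any two distinct vertices $u,v$ with $\phi(u)=\phi(v)=i$ satisfy $d_G(u,v) > s_i$. The $S$-packing chromatic number $\chi_S(G)$ is the least $k$ for which such a coloring exists. $P_n$ denotes the path on $n$ vertices. For an integer $k\ge 2$, $\mathcal{S}(k)$ is the set of packing sequences with $2^{i-1}\le s_i<2^i$ for all $i\le k-1$ and $s_k<2^{k-1}$ (so in particular $s_1=1$). *)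

theory Defs
  imports "Graph_Theory.Graph_Theory"
begin

text \<open>
  Graphs are finite simple graphs in the sense of the locale \<^locale>\<open>graph\<close>, i.e. symmetric
  loop-free digraphs without parallel arcs. Sequences are functions on the natural numbers
  that are read on the indices 1, 2, ... only; the value at 0 plays no role.
\<close>

definition packing_sequence :: "(nat \<Rightarrow> nat) \<Rightarrow> bool" where
  "packing_sequence s \<longleftrightarrow> mono_on {1..} s \<and> (\<forall>i\<ge>1. 0 < s i)"

definition packing_class :: "nat \<Rightarrow> (nat \<Rightarrow> nat) set" where
  "packing_class k =
     {s. packing_sequence s \<and> (\<forall>i\<in>{1..k - 1}. 2 ^ (i - 1) \<le> s i \<and> s i < 2 ^ i) \<and> s k < 2 ^ (k - 1)}"

text \<open>
  With unit weights the cost of a walk is its length, so this is the usual graph distance,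
  with value \<open>\<infinity>\<close> between different components.
\<close>

definition graph_dist :: "('a, 'b) pre_digraph \<Rightarrow> 'a \<Rightarrow> 'a \<Rightarrow> ereal" where
  "graph_dist G u v = wf_digraph.\<mu> G (\<lambda>_. 1) u v"

definition is_packing_coloring ::
    "(nat \<Rightarrow> nat) \<Rightarrow> ('a, 'b) pre_digraph \<Rightarrow> nat \<Rightarrow> ('a \<Rightarrow> nat) \<Rightarrow> bool" where
  "is_packing_coloring s G k \<phi> \<longleftrightarrow>
     \<phi> \<in> verts G \<rightarrow> {1..k} \<and>
     (\<forall>u\<in>verts G. \<forall>v\<in>verts G. \<forall>i. u \<noteq> v \<and> \<phi> u = i \<and> \<phi> v = i \<longrightarrow>
        graph_dist G u v > ereal (real (s i)))"

definition packing_chromatic_number :: "(nat \<Rightarrow> nat) \<Rightarrow> ('a, 'b) pre_digraph \<Rightarrow> nat" where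
  "packing_chromatic_number s G = (LEAST k. \<exists>\<phi>. is_packing_coloring s G k \<phi>)"

text \<open>The minimum above is attained for every finite graph: colour injectively.\<close>

lemma packing_coloring_exists:
  assumes "finite (verts G)"
  shows "\<exists>k \<phi>. is_packing_coloring s G k \<phi>"
proof -
  obtain f :: "'a \<Rightarrow> nat" where f: "inj_on f (verts G)" "f ` verts G = {1..card (verts G)}"
    using ex_bij_betw_finite_nat[OF assms] bij_betw_trans
      ex_bij_betw_nat_finite_1[OF assms] bij_betw_inv_into
    by (metis bij_betw_def)
  then have "is_packing_coloring s G (card (verts G)) f"
    by (auto simp: is_packing_coloring_def dest: inj_onD)
  then show ?thesis by blast
qed

definition path_graph :: "nat \<Rightarrow> nat pair_pre_digraph" where
  "path_graph n =
     \<lparr> pverts = {1..n}, parcs = {(i, j). i \<in> {1..n} \<and> j \<in> {1..n} \<and> (j = Suc i \<or> i = Suc j)} \<rparr>"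

lemma pair_graph_path_graph: "pair_graph (path_graph n)"
proof
  show "finite (parcs (path_graph n))"
    by (rule finite_subset[of _ "{1..n} \<times> {1..n}"]) (auto simp: path_graph_def)
  show "symmetric (with_proj (path_graph n))"
    by (auto simp: path_graph_def symmetric_def sym_def)
qed (auto simp: path_graph_def)

end

theory Submission
  imports Defs "HOL-Computational_Algebra.Primes"
begin

text \<open>
  Upper bound: colour the vertex \<open>v\<close> by one plus the 2-adic valuation of \<open>v\<close>, truncated at \<open>k\<close>.
  Lower bound: by induction on \<open>j\<close>, no window of \<open>2 ^ j\<close> consecutive vertices can be coloured with
  \<open>j \<le> k - 1\<close> colours. Indeed, by induction every subwindow of \<open>2 ^ (j - 1)\<close> vertices uses colour
  \<open>j\<close>, so it occurs at some \<open>u\<close> in the first half and again among the \<open>2 ^ (j - 1)\<close> vertices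
  following \<open>u\<close>; as \<open>2 ^ (j - 1) \<le> s j\<close>, these two occurrences are too close together.
\<close>

text \<open>Each arc changes the vertex number by exactly one, so the bound follows from the
  triangle inequality along the walk.\<close>

lemma path_graph_walk_length_ge:
  assumes "pre_digraph.awalk (with_proj (path_graph n)) u p v"
  shows "\<bar>real u - real v\<bar> \<le> real (length p)"
proof -
  interpret pair_graph "path_graph n" by (rule pair_graph_path_graph)
  from assms show ?thesis
  proof (induction p arbitrary: u)
    case Nil
    then show ?case by (simp add: awalk_Nil_iff)
  next
    case (Cons e p)
    then have "e \<in> parcs (path_graph n)" "u = fst e"
      and "\<bar>real (snd e) - real v\<bar> \<le> real (length p)"
      by (auto simp: awalk_Cons_iff)
    then show ?case by (auto simp: path_graph_def)
  qed
qed

lemma path_graph_walk_exists: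
  assumes "u \<in> {1..n}" "v \<in> {1..n}" "\<bar>int u - int v\<bar> = int d"
  shows "\<exists>p. pre_digraph.awalk (with_proj (path_graph n)) u p v \<and> length p = d"
proof -
  interpret pair_graph "path_graph n" by (rule pair_graph_path_graph)
  from assms show ?thesis
  proof (induction d arbitrary: u)
    case 0
    then have "awalk u [] v" unfolding awalk_Nil_iff by (simp add: path_graph_def)
    then show ?case by (intro exI[of _ "[]"]) simp
  next
    case (Suc d)
    \<comment> \<open>\<open>w\<close> is the neighbour of \<open>u\<close> one step closer to
      \<open>v\<close>. Since the distance is \<open>Suc d\<close>, \<open>u\<close> and
      \<open>v\<close> differ, so \<open>w\<close> lies between 1 and \<open>n\<close>
      again.\<close>
    define w where "w = (if u < v then Suc u else u - 1)"
    have w: "w \<in> {1..n}" "\<bar>int w - int v\<bar> = int d" and arc: "(u, w) \<in> parcs (path_graph n)"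
      using Suc.prems by (auto simp: w_def path_graph_def split: if_splits)
    from Suc.IH[OF w(1) Suc.prems(2) w(2)]
    obtain p where "awalk w p v" "length p = d" by blast
    then have "awalk u ((u, w) # p) v" "length ((u, w) # p) = Suc d"
      using arc by (auto simp: awalk_Cons_iff)
    then show ?case by blast
  qed
qed

text \<open>The distance is an infimum of walk costs, and with unit weights cost is length: a
  monotone walk attains the value, and no walk is shorter.\<close>

lemma graph_dist_path_graph:
  assumes "u \<in> {1..n}" "v \<in> {1..n}"
  shows "graph_dist (with_proj (path_graph n)) u v = ereal \<bar>real u - real v\<bar>"
proof -
  interpret pair_graph "path_graph n" by (rule pair_graph_path_graph)
  have cost: "awalk_cost (\<lambda>_. 1) p = real (length p)" for p :: "(nat \<times> nat) list"
    by (induction p) auto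
  have "\<bar>int u - int v\<bar> = int (nat \<bar>int u - int v\<bar>)" by simp
  from path_graph_walk_exists[OF assms this]
  obtain p where p: "awalk u p v" "length p = nat \<bar>int u - int v\<bar>" by blast
  then have len: "real (length p) = \<bar>real u - real v\<bar>" by linarith
  show ?thesis
    unfolding graph_dist_def
  proof (rule antisym)
    show "\<mu> (\<lambda>_. 1) u v \<le> ereal \<bar>real u - real v\<bar>"
      using min_cost_le_walk_cost[OF p(1), of "\<lambda>_. 1"] by (simp add: cost len)
    show "ereal \<bar>real u - real v\<bar> \<le> \<mu> (\<lambda>_. 1) u v"
      unfolding \<mu>_def
      by (rule INF_greatest) (auto simp: cost dest: path_graph_walk_length_ge)
  qed
qed

lemma is_packing_coloring_path_graph_iff:
  "is_packing_coloring s (with_proj (path_graph n)) k \<phi> \<longleftrightarrow>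
     \<phi> \<in> {1..n} \<rightarrow> {1..k} \<and>
     (\<forall>u\<in>{1..n}. \<forall>v\<in>{1..n}. u < v \<and> \<phi> u = \<phi> v \<longrightarrow> s (\<phi> u) < v - u)"
  (is "_ \<longleftrightarrow> _ \<and> ?far")
proof -
  \<comment> \<open>Subtraction on \<open>nat\<close> truncates, so the difference taken the wrong
    way is 0 and the disjunction says that \<open>c\<close> is below the absolute
    difference.\<close>
  have *: "ereal (real c) < graph_dist (with_proj (path_graph n)) u v \<longleftrightarrow> c < v - u \<or> c < u - v"
    if "u \<in> {1..n}" "v \<in> {1..n}" for c u v
    using that by (auto simp: graph_dist_path_graph)
  have "(\<forall>u\<in>{1..n}. \<forall>v\<in>{1..n}. \<forall>i. u \<noteq> v \<and> \<phi> u = i \<and> \<phi> v = i \<longrightarrow>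
          ereal (real (s i)) < graph_dist (with_proj (path_graph n)) u v) \<longleftrightarrow>
        (\<forall>u\<in>{1..n}. \<forall>v\<in>{1..n}. u \<noteq> v \<and> \<phi> u = \<phi> v \<longrightarrow> s (\<phi> u) < v - u \<or> s (\<phi> u) < u - v)"
    using * by metis
  also have "\<dots> \<longleftrightarrow> ?far"
    by (metis diff_is_0_eq less_or_eq_imp_le nat_neq_iff not_less_zero)
  finally show ?thesis
    by (simp add: is_packing_coloring_def path_graph_def)
qed

lemma no_packing_coloring_window:
  fixes s \<phi> :: "nat \<Rightarrow> nat"
  assumes "\<And>i. i \<in> {1..j} \<Longrightarrow> 2 ^ (i - 1) \<le> s i"
    and "\<And>u v. u \<in> {a..<a + 2 ^ j} \<Longrightarrow> v \<in> {a..<a + 2 ^ j} \<Longrightarrow> u < v \<Longrightarrow> \<phi> u = \<phi> v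
           \<Longrightarrow> s (\<phi> u) < v - u"
  shows "\<not> \<phi> ` {a..<a + 2 ^ j} \<subseteq> {1..j}"
  using assms
proof (induction j arbitrary: a)
  case 0
  then show ?case by auto
next
  case (Suc j)
  show ?case
  proof
    assume range: "\<phi> ` {a..<a + 2 ^ Suc j} \<subseteq> {1..Suc j}"
    \<comment> \<open>The bound on \<open>b\<close> includes \<open>a + 2 ^ j\<close>, because the
      second use takes \<open>b = Suc u\<close> with \<open>u\<close> possibly the last vertex of
      the first half.\<close>
    have hit: "\<exists>u\<in>{b..<b + 2 ^ j}. \<phi> u = Suc j" if b: "a \<le> b" "b \<le> a + 2 ^ j" for b
    proof -
      have sub: "{b..<b + 2 ^ j} \<subseteq> {a..<a + 2 ^ Suc j}" using b by auto
      have "\<not> \<phi> ` {b..<b + 2 ^ j} \<subseteq> {1..j}"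
      proof (rule Suc.IH)
        show "2 ^ (i - 1) \<le> s i" if "i \<in> {1..j}" for i
          using Suc.prems(1) that by auto
        show "s (\<phi> u) < v - u"
          if "u \<in> {b..<b + 2 ^ j}" "v \<in> {b..<b + 2 ^ j}" "u < v" "\<phi> u = \<phi> v" for u v
          using Suc.prems(2) that sub by blast
      qed
      then obtain u where u: "u \<in> {b..<b + 2 ^ j}" "\<phi> u \<notin> {1..j}" by blast
      with range sub have "\<phi> u \<in> {1..Suc j}" by blast
      with u show ?thesis by (intro bexI[of _ u]) auto
    qed
    obtain u where u: "u \<in> {a..<a + 2 ^ j}" "\<phi> u = Suc j" using hit[of a] by auto
    obtain v where v: "v \<in> {Suc u..<Suc u + 2 ^ j}" "\<phi> v = Suc j" using hit[of "Suc u"] u by auto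
    have "s (\<phi> u) < v - u" using u v by (intro Suc.prems(2)) auto
    moreover have "2 ^ j \<le> s (Suc j)" using Suc.prems(1)[of "Suc j"] by simp
    \<comment> \<open>From \<open>v < Suc u + 2 ^ j\<close> follows
      \<open>v - u \<le> 2 ^ j \<le> s (Suc j)\<close>, against
      \<open>s (\<phi> u) < v - u\<close>.\<close>
    ultimately show False using u v by auto
  qed
qed

text \<open>After the common power of 2 is taken out, both cofactors are odd; their difference is
  even and supplies one more factor 2.\<close>

lemma power_dvd_diff_if_multiplicity_eq:
  fixes u v :: nat
  assumes "0 < u" "0 < v" "multiplicity 2 u = multiplicity 2 v"
  shows "2 ^ Suc (multiplicity 2 u) dvd v - u"
proof -
  obtain a where a: "u = 2 ^ multiplicity 2 u * a" "odd a"
    using assms(1) by (metis multiplicity_decompose' neq0_conv odd_one)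
  obtain b where b: "v = 2 ^ multiplicity 2 v * b" "odd b"
    using assms(2) by (metis multiplicity_decompose' neq0_conv odd_one)
  have "v - u = 2 ^ multiplicity 2 u * (b - a)"
    using a b assms(3) by (metis diff_mult_distrib2)
  moreover have "2 dvd b - a" using a b by simp
  ultimately show ?thesis by (simp add: mult_dvd_mono mult.commute)
qed

lemma packing_coloring_multiplicity:
  assumes "1 \<le> k" "s \<in> packing_class k" "n < 2 ^ l"
  shows "is_packing_coloring s (with_proj (path_graph n)) (min k l)
           (\<lambda>v. min k (Suc (multiplicity 2 v)))"
  unfolding is_packing_coloring_path_graph_iff
proof (intro conjI ballI impI funcsetI)
  fix v assume v: "v \<in> {1..n}"
  then have "2 ^ multiplicity 2 v \<le> v" by (intro dvd_imp_le multiplicity_dvd) auto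
  with v assms(3) have "(2::nat) ^ multiplicity 2 v < 2 ^ l"
    by (meson atLeastAtMost_iff le_less_trans order_trans)
  then have "multiplicity 2 v < l" by simp
  with assms(1) show "min k (Suc (multiplicity 2 v)) \<in> {1..min k l}" by auto
next
  fix u v assume uv: "u \<in> {1..n}" "v \<in> {1..n}"
    and "u < v \<and> min k (Suc (multiplicity 2 u)) = min k (Suc (multiplicity 2 v))"
  then have less: "u < v" and eq: "min k (Suc (multiplicity 2 u)) = min k (Suc (multiplicity 2 v))"
    by auto
  show "s (min k (Suc (multiplicity 2 u))) < v - u"
  proof (cases "Suc (multiplicity 2 u) < k")
    case True
    then have "multiplicity 2 u = multiplicity 2 v" using eq by (auto simp: min_def split: if_splits)
    then have "2 ^ Suc (multiplicity 2 u) dvd v - u"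
      using uv by (intro power_dvd_diff_if_multiplicity_eq) auto
    then have "2 ^ Suc (multiplicity 2 u) \<le> v - u" using less by (intro dvd_imp_le) auto
    moreover have "s (Suc (multiplicity 2 u)) < 2 ^ Suc (multiplicity 2 u)"
    proof -
      have "Suc (multiplicity 2 u) \<in> {1..k - 1}" using True by auto
      with assms(2) show ?thesis unfolding packing_class_def by blast
    qed
    ultimately show ?thesis using True by (simp add: min_def)
  next
    \<comment> \<open>Colour \<open>k\<close> collects all valuations from \<open>k - 1\<close> on.
      These may differ, so only the common divisor \<open>2 ^ (k - 1)\<close> is available, which is
      what the bound on \<open>s k\<close> asks for.\<close>
    case False
    then have "k - 1 \<le> multiplicity 2 u" "k - 1 \<le> multiplicity 2 v" using eq by auto
    then have "2 ^ (k - 1) dvd u" "2 ^ (k - 1) dvd v" by (auto intro: multiplicity_dvd')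
    then have "2 ^ (k - 1) dvd v - u" by (rule dvd_diff_nat[rotated])
    then have "2 ^ (k - 1) \<le> v - u" using less by (intro dvd_imp_le) auto
    moreover have "s k < 2 ^ (k - 1)" using assms(2) by (simp add: packing_class_def)
    ultimately show ?thesis using False by (simp add: min_def)
  qed
qed

text \<open>With \<open>j \<le> l\<close> the first \<open>2 ^ j\<close> vertices form a window
  inside the path, and \<open>j < k\<close> supplies the lower bounds on \<open>s\<close> that rule
  out colouring it with \<open>j\<close> colours.\<close>

lemma packing_coloring_path_graph_card_ge:
  assumes "s \<in> packing_class k" "2 ^ l \<le> n"
    and "is_packing_coloring s (with_proj (path_graph n)) j \<phi>"
  shows "min k (Suc l) \<le> j"
proof (rule ccontr)
  assume "\<not> min k (Suc l) \<le> j"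
  then have j: "j < k" "j \<le> l" by auto
  then have "(2::nat) ^ j \<le> 2 ^ l" by simp
  with assms(2) have "2 ^ j \<le> n" by (rule order_trans[rotated])
  then have sub: "{1..<1 + 2 ^ j} \<subseteq> {1..n}" by auto
  have col: "\<phi> \<in> {1..n} \<rightarrow> {1..j}"
    and far: "\<And>u v. u \<in> {1..n} \<Longrightarrow> v \<in> {1..n} \<Longrightarrow> u < v \<Longrightarrow> \<phi> u = \<phi> v \<Longrightarrow> s (\<phi> u) < v - u"
    using assms(3) unfolding is_packing_coloring_path_graph_iff by blast+
  have "\<not> \<phi> ` {1..<1 + 2 ^ j} \<subseteq> {1..j}"
  proof (rule no_packing_coloring_window)
    show "2 ^ (i - 1) \<le> s i" if "i \<in> {1..j}" for i
      using assms(1) j that unfolding packing_class_def by auto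
  qed (use far sub in blast)
  with col sub show False by blast
qed

lemma packing_chromatic_number_path_graph:
  assumes "1 \<le> k" "s \<in> packing_class k" "2 ^ l \<le> n" "n < 2 ^ Suc l"
  shows "packing_chromatic_number s (with_proj (path_graph n)) = min k (Suc l)"
  unfolding packing_chromatic_number_def
  using packing_coloring_multiplicity[OF assms(1,2,4)] packing_coloring_path_graph_card_ge[OF assms(2,3)]
  by (intro Least_equality) blast+

theorem theorem3p1:
  fixes k n :: nat and s :: "nat \<Rightarrow> nat"
  assumes "k \<ge> 2" and "s \<in> packing_class k" and "n \<ge> 1"
  shows "int (packing_chromatic_number s (with_proj (path_graph n)))
           = min (int k) (\<lfloor>log 2 (real n)\<rfloor> + 1)
         \<and> (n \<ge> 2 ^ (k - 1) \<longrightarrow> packing_chromatic_number s (with_proj (path_graph n)) = k)"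
proof -
  obtain l where l: "2 ^ l \<le> n" "n < 2 ^ Suc l"
    using ex_power_ivl1[of 2 n] assms(3) by auto
  have chi: "packing_chromatic_number s (with_proj (path_graph n)) = min k (Suc l)"
    using assms l by (intro packing_chromatic_number_path_graph) auto
  have "\<lfloor>log 2 (real n)\<rfloor> = int l"
    using floor_log_nat_eq_if[of 2 l n] l by simp
  \<comment> \<open>If \<open>2 ^ (k - 1) \<le> n < 2 ^ Suc l\<close>, comparing exponents shows
    that the minimum is \<open>k\<close>.\<close>
  moreover have "k \<le> Suc l" if "2 ^ (k - 1) \<le> n"
  proof -
    have "(2::nat) ^ (k - 1) < 2 ^ Suc l" using that l(2) by linarith
    then have "k - 1 < Suc l" by (rule power_less_imp_less_exp[rotated]) simp
    then show ?thesis by simp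
  qed
  ultimately show ?thesis using chi by auto
qed

end
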